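(* Let $H^\tau$ be an oriented $\ell$-regular bipartite graph on $m$ vertices (an orientation of an $\ell$-regular bipartite graph $H$ with bipartition $(X,Y)$) with maximum skew energy $\mathcal{E}_S(H^\tau)=m\sqrt{\ell}$, and let $G^\sigma$ be an oriented $k$-regular graph on $n$ vertices with maximum skew energy $\mathcal{E}_S(G^\sigma)=n\sqrt{k}$. Then the oriented graph $(H^\tau\Box G^\sigma)^o$ of $H\Box G$ has the maximum skew energy $\mathcal{E}_S((H^\tau\Box G^\sigma)^o)=mn\sqrt{\ell+k}$.
   Context: All graphs are finite, simple and undirected. An orientation $\sigma$ of a graph $G$ with vertices $v_1,\dots,v_n$ assigns a direction to each edge of $G$; the resulting oriented graph is $G^\sigma$, and it is called $k$-regular (bipartite) if the underlying undirected graph $G$ is. Its skew-adjacency matrix $S(G^\sigma)=[s_{pq}]$ is the $n\times n$ matrix with $s_{pq}=1$ and $s_{qp}=-1$ if there is an arc from $v_p$ to $v_q$, and $s_{pq}=s_{qp}=0$ if $v_p,v_q$ are not adjacent. The skew energy $\mathcal{E}_S(G^\sigma)$ is the sum of the absolute values of all eigenvalues (with multiplicity) of $S(G^\sigma)$. It is known that $\mathcal{E}_S(G^\sigma)\le n\sqrt{\Delta}$ for an oriented graph on $n$ vertices whose underlying graph has maximum degree $\Delta$, with equality if and only if $S(G^\sigma)^TS(G^\sigma)=\Delta I_n$; "maximum skew energy" means that this upper bound is attained. The Cartesian product $H\Box G$ has vertex set $V(H)\times V(G)$, with $(u_1,v_1)$ and $(u_2,v_2)$ adjacent if and only if $u_1=u_2$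 and $v_1v_2\in E(G)$, or $v_1=v_2$ and $u_1u_2\in E(H)$. Given orientations $H^\tau$ and $G^\sigma$, the oriented graph $H^\tau\Box G^\sigma$ is the orientation of $H\Box G$ with an arc from $(u_1,v_1)$ to $(u_2,v_2)$ if and only if $u_1=u_2$ and $(v_1,v_2)$ is an arc of $G^\sigma$, or $v_1=v_2$ and $(u_1,u_2)$ is an arc of $H^\tau$. When $H$ is bipartite with bipartition $(X,Y)$, $(H^\tau\Box G^\sigma)^o$ denotes the orientation of $H\Box G$ obtained from $H^\tau\Box G^\sigma$ by reversing every arc from $(u,v_1)$ to $(u,v_2)$ with $u\in Y$, and leaving all other arcs unchanged. *)

theory Defs
  imports
    "Graph_Theory.Graph_Theory"
    "Jordan_Normal_Form.Spectral_Radius"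
begin

text \<open>
  A finite simple undirected graph is a \<open>pair_graph\<close>: each edge \<open>uv\<close> is represented by the
  two arcs \<open>(u, v)\<close> and \<open>(v, u)\<close>, so the degree of a vertex is its \<open>out_degree\<close>.
  An oriented graph is a \<open>pair_pre_digraph\<close> that keeps exactly one of the two arcs.
\<close>

definition is_orientation :: "'a pair_pre_digraph \<Rightarrow> 'a pair_pre_digraph \<Rightarrow> bool" where
  "is_orientation G D \<longleftrightarrow>
     pverts D = pverts G \<and>
     parcs D \<union> (parcs D)\<inverse> = parcs G \<and>
     parcs D \<inter> (parcs D)\<inverse> = {}"

definition regular_graph :: "nat \<Rightarrow> 'a pair_pre_digraph \<Rightarrow> bool" where
  "regular_graph k G \<longleftrightarrow> (\<forall>v \<in> pverts G. out_degree (with_proj G) v = k)"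

definition max_degree :: "'a pair_pre_digraph \<Rightarrow> nat" where
  "max_degree G = Max (out_degree (with_proj G) ` pverts G)"

definition bipartition :: "'a pair_pre_digraph \<Rightarrow> 'a set \<Rightarrow> 'a set \<Rightarrow> bool" where
  "bipartition G X Y \<longleftrightarrow>
     X \<union> Y = pverts G \<and> X \<inter> Y = {} \<and>
     (\<forall>(u, v) \<in> parcs G. (u \<in> X \<and> v \<in> Y) \<or> (u \<in> Y \<and> v \<in> X))"

definition vertex_enumeration :: "'a pair_pre_digraph \<Rightarrow> 'a list \<Rightarrow> bool" where
  "vertex_enumeration G vs \<longleftrightarrow> distinct vs \<and> set vs = pverts G"

text \<open>
  The list \<open>vs\<close> fixes the numbering of the vertices. The matrix has complex entries because its
  eigenvalues are purely imaginary.
\<close>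

definition skew_adjacency_mat :: "'a list \<Rightarrow> 'a pair_pre_digraph \<Rightarrow> complex mat" where
  "skew_adjacency_mat vs D = mat (length vs) (length vs) (\<lambda>(p, q).
     if (vs ! p, vs ! q) \<in> parcs D then 1
     else if (vs ! q, vs ! p) \<in> parcs D then - 1
     else 0)"

text \<open>Eigenvalues are counted with algebraic multiplicity.\<close>

definition skew_energy :: "'a list \<Rightarrow> 'a pair_pre_digraph \<Rightarrow> real" where
  "skew_energy vs D =
     (let S = skew_adjacency_mat vs D
      in \<Sum>z \<in> spectrum S. real (Polynomial.order z (char_poly S)) * cmod z)"

text \<open>\<open>D\<close>, an orientation of \<open>G\<close>, attains the general upper bound for the skew energy.\<close>

definition has_max_skew_energy ::
    "'a list \<Rightarrow> 'a pair_pre_digraph \<Rightarrow> 'a pair_pre_digraph \<Rightarrow> bool" where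
  "has_max_skew_energy vs G D \<longleftrightarrow>
     skew_energy vs D = real (card (pverts G)) * sqrt (real (max_degree G))"

text \<open>
  The same formula gives the Cartesian product of undirected graphs (read as symmetric digraphs)
  and of oriented graphs.
\<close>

definition cartesian_product ::
    "'a pair_pre_digraph \<Rightarrow> 'b pair_pre_digraph \<Rightarrow> ('a \<times> 'b) pair_pre_digraph"
    (infixr \<open>\<box>\<close> 75) where
  "H \<box> G = \<lparr> pverts = pverts H \<times> pverts G,
     parcs = {((u1, v1), (u2, v2)) | u1 v1 u2 v2.
       (u1 \<in> pverts H \<and> u1 = u2 \<and> (v1, v2) \<in> parcs G) \<or>
       (v1 \<in> pverts G \<and> v1 = v2 \<and> (u1, u2) \<in> parcs H)} \<rparr>"

definition reverse_fibre_arcs ::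
    "'a set \<Rightarrow> ('a \<times> 'b) pair_pre_digraph \<Rightarrow> ('a \<times> 'b) pair_pre_digraph" where
  "reverse_fibre_arcs Y D = \<lparr> pverts = pverts D,
     parcs = {(x, y) \<in> parcs D. \<not> (fst x = fst y \<and> fst x \<in> Y)} \<union>
             {(y, x) | x y. (x, y) \<in> parcs D \<and> fst x = fst y \<and> fst x \<in> Y} \<rparr>"

lemma pair_graph_cartesian_product:
  assumes "pair_graph H" and "pair_graph G"
  shows "pair_graph (H \<box> G)"
proof -
  interpret H: pair_graph H by fact
  interpret G: pair_graph G by fact
  have sub: "parcs (H \<box> G) \<subseteq> (pverts H \<times> pverts G) \<times> (pverts H \<times> pverts G)"
    by (auto simp: cartesian_product_def dest: H.wellformed' G.wellformed')
  have fin: "finite (pverts H \<times> pverts G)"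
    using H.pair_finite_verts G.pair_finite_verts by simp
  have "sym (parcs H)" "sym (parcs G)"
    using H.pair_sym_arcs G.pair_sym_arcs by (auto simp: symmetric_def)
  then have "sym (parcs (H \<box> G))"
    by (auto simp: cartesian_product_def sym_def)
  moreover have "fst e \<noteq> snd e" if "e \<in> parcs (H \<box> G)" for e
    using that by (auto simp: cartesian_product_def dest: H.pair_no_loops G.pair_no_loops)
  moreover have "pverts (H \<box> G) = pverts H \<times> pverts G"
    by (simp add: cartesian_product_def)
  moreover have "finite (parcs (H \<box> G))"
    by (rule finite_subset[OF sub]) (use fin in auto)
  ultimately show ?thesis
    using sub fin by unfold_locales (force simp: symmetric_def)+
qed

lemma is_orientation_product:
  assumes "pair_graph H" "is_orientation H H\<tau>"
    and "pair_graph G" "is_orientation G G\<sigma>"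
  shows "is_orientation (H \<box> G) (H\<tau> \<box> G\<sigma>)"
    and "is_orientation (H \<box> G) (reverse_fibre_arcs Y (H\<tau> \<box> G\<sigma>))"
proof -
  interpret H: pair_graph H by fact
  interpret G: pair_graph G by fact
  have v: "pverts H\<tau> = pverts H" "pverts G\<sigma> = pverts G"
    using assms by (auto simp: is_orientation_def)
  have H: "(a, b) \<in> parcs H \<longleftrightarrow> (a, b) \<in> parcs H\<tau> \<or> (b, a) \<in> parcs H\<tau>"
    "\<not> ((a, b) \<in> parcs H\<tau> \<and> (b, a) \<in> parcs H\<tau>)" for a b
    using assms(2) by (auto simp: is_orientation_def)
  have G: "(a, b) \<in> parcs G \<longleftrightarrow> (a, b) \<in> parcs G\<sigma> \<or> (b, a) \<in> parcs G\<sigma>"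
    "\<not> ((a, b) \<in> parcs G\<sigma> \<and> (b, a) \<in> parcs G\<sigma>)" for a b
    using assms(4) by (auto simp: is_orientation_def)
  have nl: "(a, a) \<notin> parcs H\<tau>" "(b, b) \<notin> parcs G\<sigma>" for a b
    using H(2)[of a a] G(2)[of b b] by auto
  show main: "is_orientation (H \<box> G) (H\<tau> \<box> G\<sigma>)"
    using H(2) G(2) nl by (auto simp: is_orientation_def cartesian_product_def v H(1) G(1))
  show "is_orientation (H \<box> G) (reverse_fibre_arcs Y (H\<tau> \<box> G\<sigma>))"
    using main by (auto simp: is_orientation_def reverse_fibre_arcs_def)
qed

end

theory Submission
  imports Defs
begin

text \<open>
  For an oriented \<open>k\<close>-regular graph on \<open>n\<close> vertices with skew-adjacency matrix \<open>S\<close>, maximum skew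
  energy is the same as \<open>S\<^sup>2 = - k I\<close>, and this matrix equation survives the product construction.

  The equation gives the energy because every eigenvalue \<open>z\<close> then satisfies \<open>z\<^sup>2 = - k\<close>.
  For the converse, \<open>S\<close> is skew-Hermitian, so its eigenvalues \<open>z\<^sub>1, \<dots>, z\<^sub>n\<close> are purely imaginary,
  and regularity says that the sum of the \<open>\<bar>z\<^sub>i\<bar>\<^sup>2\<close>, which is minus the trace of \<open>S\<^sup>2\<close>, equals
  \<open>n k\<close>. If also the sum of the \<open>\<bar>z\<^sub>i\<bar>\<close> is \<open>n \<surd>k\<close>, then the sum of the squares
  \<open>(\<bar>z\<^sub>i\<bar> - \<surd>k)\<^sup>2\<close> vanishes and all moduli equal \<open>\<surd>k\<close>. The Hermitian matrix
  \<open>N = S\<^sup>2 + k I\<close> thus has only zero eigenvalues. Instead of diagonalising it, the proof computes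
  its squared Frobenius norm, the trace of \<open>N\<^sup>2\<close>, from the traces of \<open>S\<^sup>2\<close> and \<open>S\<^sup>4\<close>. This
  trace is \<open>0\<close>, so \<open>N = 0\<close> (\<open>skew_hermitian_square_eq_scalar\<close>).

  For the product, put \<open>\<epsilon> u = -1\<close> for \<open>u \<in> Y\<close> and \<open>\<epsilon> u = 1\<close> otherwise. Its matrix is
  \<open>W = E \<otimes> S\<^sub>G + S\<^sub>H \<otimes> I\<close>, where \<open>E\<close> is the diagonal matrix of \<open>\<epsilon>\<close>. Every edge of \<open>H\<close> joins
  vertices of opposite sign, so \<open>E S\<^sub>H = - S\<^sub>H E\<close>, the mixed terms of \<open>W\<^sup>2\<close> cancel, and what is left
  is \<open>E\<^sup>2 \<otimes> S\<^sub>G\<^sup>2 + S\<^sub>H\<^sup>2 \<otimes> I = - (l + k) I\<close> (\<open>skew_square_product\<close>). The diagonal of this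
  equation also shows that the product graph is \<open>(l + k)\<close>-regular.
\<close>

section \<open>Traces and eigenvalues\<close>

definition mat_trace :: "'a::comm_monoid_add mat \<Rightarrow> 'a" where
  "mat_trace A = (\<Sum>i<dim_row A. A $$ (i, i))"

lemma mult_mat_entry:
  assumes "A \<in> carrier_mat n m" and "B \<in> carrier_mat m r" and "i < n" and "j < r"
  shows "(A * B) $$ (i, j) = (\<Sum>k<m. A $$ (i, k) * B $$ (k, j))"
  using assms by (simp add: scalar_prod_def lessThan_atLeast0)

lemma mult_mat_vec_entry:
  assumes "A \<in> carrier_mat n m" and "v \<in> carrier_vec m" and "i < n"
  shows "(A *\<^sub>v v) $ i = (\<Sum>j<m. A $$ (i, j) * v $ j)"
  using assms by (simp add: scalar_prod_def lessThan_atLeast0)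

lemma mat_trace_mult_comm:
  fixes A B :: "'a::comm_semiring_0 mat"
  assumes "A \<in> carrier_mat n m" and "B \<in> carrier_mat m n"
  shows "mat_trace (A * B) = mat_trace (B * A)"
proof -
  have "mat_trace (A * B) = (\<Sum>i<n. \<Sum>k<m. A $$ (i, k) * B $$ (k, i))"
    using assms mult_mat_entry[OF assms] by (simp add: mat_trace_def)
  also have "\<dots> = (\<Sum>k<m. \<Sum>i<n. B $$ (k, i) * A $$ (i, k))"
    by (subst sum.swap) (simp add: mult.commute)
  also have "\<dots> = mat_trace (B * A)"
    using assms mult_mat_entry[OF assms(2,1)] by (simp add: mat_trace_def)
  finally show ?thesis .
qed

lemma mat_trace_similar:
  fixes A B :: "'a::comm_ring_1 mat"
  assumes A: "A \<in> carrier_mat n n" and sim: "similar_mat_wit A B P Q"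
  shows "mat_trace A = mat_trace B"
proof -
  note w = similar_mat_witD2[OF A sim]
  have "mat_trace A = mat_trace (P * (B * Q))"
    using w by (simp add: assoc_mult_mat[of P n n B n Q n])
  also have "\<dots> = mat_trace (B * Q * P)"
    using w by (intro mat_trace_mult_comm[of _ n n]) auto
  also have "B * Q * P = B"
    using w by (simp add: assoc_mult_mat[of B n n Q n P n])
  finally show ?thesis .
qed

lemma upper_triangular_pow_mat:
  fixes B :: "'a::comm_ring_1 mat"
  assumes B: "B \<in> carrier_mat n n" and ut: "upper_triangular B" and "i < n" and "j \<le> i"
  shows "(B ^\<^sub>m r) $$ (i, j) = (if i = j then B $$ (i, i) ^ r else 0)"
  using assms(3,4)
proof (induction r arbitrary: i j)
  case 0
  then show ?case using B by simp
next
  case (Suc r)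
  have "(B ^\<^sub>m Suc r) $$ (i, j) = (\<Sum>k<n. (B ^\<^sub>m r) $$ (i, k) * B $$ (k, j))"
    using Suc.prems B mult_mat_entry[OF pow_carrier_mat[OF B] B, of i j r] by simp
  \<comment> \<open>For \<open>k < i\<close> the first factor vanishes by induction, for \<open>k > j\<close> the second one does.\<close>
  also have "\<dots> = (\<Sum>k<n. if k = i then (if i = j then B $$ (i, i) ^ Suc r else 0) else 0)"
  proof (rule sum.cong[OF refl])
    fix k assume k: "k \<in> {..<n}"
    consider "k < i" | "k = i" | "k > i" by linarith
    then show "(B ^\<^sub>m r) $$ (i, k) * B $$ (k, j)
      = (if k = i then (if i = j then B $$ (i, i) ^ Suc r else 0) else 0)"
    proof cases
      case 1
      then show ?thesis using Suc.IH[of i k] Suc.prems by simp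
    next
      case 2
      then show ?thesis using Suc.IH[of i i] Suc.prems B upper_triangularD[OF ut, of j i]
        by auto
    next
      case 3
      then show ?thesis using Suc.prems k B upper_triangularD[OF ut, of j k] by auto
    qed
  qed
  also have "\<dots> = (if i = j then B $$ (i, i) ^ Suc r else 0)"
    using Suc.prems by simp
  finally show ?case .
qed

text \<open>
  Schur triangularisation is a similarity that puts the eigenvalues on the diagonal, and the
  diagonal of a power of a triangular matrix consists of the powers of its diagonal.
\<close>

lemma mat_trace_pow_eq_sum_eigenvalues:
  fixes A :: "complex mat"
  assumes A: "A \<in> carrier_mat n n" and cp: "char_poly A = (\<Prod>z\<leftarrow>zs. [:- z, 1:])"
  shows "mat_trace (A ^\<^sub>m r) = (\<Sum>z\<leftarrow>zs. z ^ r)"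
proof -
  obtain B P Q where schur: "schur_decomposition A zs = (B, P, Q)"
    by (metis prod_cases3)
  then have sim: "similar_mat_wit A B P Q" and ut: "upper_triangular B" and d: "diag_mat B = zs"
    using schur_decomposition[OF A cp] by auto
  have B: "B \<in> carrier_mat n n"
    using similar_mat_witD2[OF A sim] by simp
  have "mat_trace (A ^\<^sub>m r) = mat_trace (B ^\<^sub>m r)"
    by (rule mat_trace_similar[OF pow_carrier_mat[OF A] similar_mat_wit_pow[OF sim]])
  also have "\<dots> = (\<Sum>i<n. B $$ (i, i) ^ r)"
    using B upper_triangular_pow_mat[OF B ut] by (simp add: mat_trace_def)
  also have "\<dots> = (\<Sum>z\<leftarrow>diag_mat B. z ^ r)"
    using B by (simp add: diag_mat_def sum_list_sum_nth lessThan_atLeast0)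
  finally show ?thesis unfolding d .
qed

lemma sum_spectrum_order_eq_sum_list:
  fixes A :: "complex mat" and f :: "complex \<Rightarrow> real"
  assumes A: "A \<in> carrier_mat n n" and cp: "char_poly A = (\<Prod>z\<leftarrow>zs. [:- z, 1:])"
  shows "(\<Sum>z\<in>spectrum A. real (Polynomial.order z (char_poly A)) * f z) = (\<Sum>z\<leftarrow>zs. f z)"
proof -
  have "spectrum A = set zs"
    unfolding spectrum_def eigenvalue_root_char_poly[OF A] cp
    by (auto simp: poly_prod_list prod_list_zero_iff)
  moreover have "Polynomial.order z (char_poly A) = count_list zs z" for z
  proof -
    have "Polynomial.order z (\<Prod>a\<leftarrow>as. [:- a, 1:]) = count_list as z" for as :: "complex list"
    proof (induction as)
      case (Cons a as)
      have "Polynomial.order z ([:- a, 1:] * (\<Prod>a\<leftarrow>as. [:- a, 1:]))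
        = Polynomial.order z [:- a, 1:] + Polynomial.order z (\<Prod>a\<leftarrow>as. [:- a, 1:])"
        by (rule order_mult) (simp only: mult_eq_0_iff prod_list_zero_iff, auto)
      then show ?case using Cons by (simp add: order_linear')
    qed simp
    then show ?thesis by (simp add: cp)
  qed
  moreover have "(\<Sum>z\<in>Z. real (count_list as z) * f z) = (\<Sum>z\<leftarrow>as. f z)"
    if "finite Z" "set as \<subseteq> Z" for Z as
    using that(2)
  proof (induction as)
    case (Cons a as)
    have "(\<Sum>z\<in>Z. real (count_list (a # as) z) * f z)
      = (\<Sum>z\<in>Z. (if z = a then f a else 0) + real (count_list as z) * f z)"
      by (intro sum.cong refl) (simp add: algebra_simps)
    then show ?case
      using Cons \<open>finite Z\<close> by (simp add: sum.distrib)
  qed simp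
  ultimately show ?thesis by simp
qed

section \<open>Skew-Hermitian matrices with extremal eigenvalue sum\<close>

lemma eigenvector_of_root:
  fixes A :: "complex mat"
  assumes A: "A \<in> carrier_mat n n" and cp: "char_poly A = (\<Prod>z\<leftarrow>zs. [:- z, 1:])"
    and z: "z \<in> set zs"
  obtains v where "v \<in> carrier_vec n" and "v \<noteq> 0\<^sub>v n" and "A *\<^sub>v v = z \<cdot>\<^sub>v v"
proof -
  have "poly (char_poly A) z = 0"
    using z unfolding cp by (auto simp: poly_prod_list prod_list_zero_iff)
  then have "eigenvalue A z"
    by (simp add: eigenvalue_root_char_poly[OF A])
  then show ?thesis
    using that A unfolding eigenvalue_def eigenvector_def by auto
qed

text \<open>
  With an eigenvector \<open>v\<close>, the number \<open>v\<^sup>* A v = z \<bar>v\<bar>\<^sup>2\<close> is minus its own conjugate.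
\<close>

lemma skew_hermitian_eigenvalue_imaginary:
  fixes A :: "complex mat"
  assumes A: "A \<in> carrier_mat n n"
    and skew: "\<And>i j. i < n \<Longrightarrow> j < n \<Longrightarrow> A $$ (j, i) = - cnj (A $$ (i, j))"
    and v: "v \<in> carrier_vec n" "v \<noteq> 0\<^sub>v n" "A *\<^sub>v v = z \<cdot>\<^sub>v v"
  shows "Re z = 0"
proof -
  define s where "s = (\<Sum>i<n. (cmod (v $ i))\<^sup>2)"
  have Av: "(\<Sum>j<n. A $$ (i, j) * v $ j) = z * v $ i" if "i < n" for i
    using mult_mat_vec_entry[OF A v(1) that] that v by simp
  have quad: "(\<Sum>i<n. \<Sum>j<n. cnj (v $ i) * A $$ (i, j) * v $ j) = z * of_real s"
  proof -
    have "(\<Sum>i<n. \<Sum>j<n. cnj (v $ i) * A $$ (i, j) * v $ j)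
      = (\<Sum>i<n. cnj (v $ i) * (\<Sum>j<n. A $$ (i, j) * v $ j))"
      by (simp add: sum_distrib_left mult.assoc)
    also have "\<dots> = (\<Sum>i<n. z * (v $ i * cnj (v $ i)))"
      by (intro sum.cong) (auto simp: Av)
    also have "\<dots> = z * of_real s"
      by (simp only: s_def of_real_sum sum_distrib_left complex_norm_square)
    finally show ?thesis .
  qed
  have "cnj (z * of_real s) = (\<Sum>i<n. \<Sum>j<n. v $ i * cnj (A $$ (i, j)) * cnj (v $ j))"
    unfolding quad[symmetric] by simp
  also have "\<dots> = (\<Sum>i<n. \<Sum>j<n. - (cnj (v $ j) * A $$ (j, i) * v $ i))"
  proof (intro sum.cong refl)
    fix i j assume "i \<in> {..<n}" "j \<in> {..<n}"
    then have "A $$ (j, i) = - cnj (A $$ (i, j))" by (intro skew) auto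
    then show "v $ i * cnj (A $$ (i, j)) * cnj (v $ j) = - (cnj (v $ j) * A $$ (j, i) * v $ i)"
      by simp
  qed
  also have "\<dots> = - (z * of_real s)"
    by (subst sum.swap) (simp add: sum_negf quad)
  finally have "Re (cnj (z * of_real s)) = Re (- (z * of_real s))" by simp
  then have "Re z * s = 0" by simp
  moreover have "s \<noteq> 0"
  proof
    assume "s = 0"
    then have "\<forall>i<n. v $ i = 0"
      by (simp add: s_def sum_nonneg_eq_0_iff)
    then show False using v(1,2) by auto
  qed
  ultimately show ?thesis by simp
qed

text \<open>
  This is the equality case of the Cauchy-Schwarz inequality between \<open>xs\<close> and a constant vector:
  the sum of the \<open>(x - c)\<^sup>2\<close> expands to zero.
\<close>

lemma all_eq_of_sum_and_sum_squares:
  fixes xs :: "real list"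
  assumes "(\<Sum>x\<leftarrow>xs. x) = real (length xs) * c" and "(\<Sum>x\<leftarrow>xs. x\<^sup>2) = real (length xs) * c\<^sup>2"
    and "x \<in> set xs"
  shows "x = c"
proof -
  have "(\<Sum>x\<leftarrow>xs. (x - c)\<^sup>2) = (\<Sum>x\<leftarrow>xs. x\<^sup>2) - 2 * c * (\<Sum>x\<leftarrow>xs. x) + real (length xs) * c\<^sup>2"
    by (induction xs) (simp_all add: power2_eq_square algebra_simps)
  also have "\<dots> = 0"
    unfolding assms(1,2) by (simp add: power2_eq_square)
  finally have "\<forall>y \<in> set (map (\<lambda>x. (x - c)\<^sup>2) xs). y = 0"
    by (subst (asm) sum_list_nonneg_eq_0_iff) auto
  then show ?thesis using assms(3) by simp
qed

text \<open>
  Comparing the trace of \<open>A\<^sup>2\<close> with the sum of the moduli forces \<open>z\<^sup>2 = - c\<close> for every eigenvalue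
  \<open>z\<close>, which gives the trace of \<open>A\<^sup>4\<close>. Since \<open>A\<^sup>2 + c I\<close> is Hermitian, its squared Frobenius
  norm is a combination of these two traces, namely \<open>n c\<^sup>2 - 2 n c\<^sup>2 + n c\<^sup>2 = 0\<close>.
\<close>

lemma skew_hermitian_square_eq_scalar:
  fixes A :: "complex mat" and c :: real
  assumes A: "A \<in> carrier_mat n n"
    and skew: "\<And>i j. i < n \<Longrightarrow> j < n \<Longrightarrow> A $$ (j, i) = - cnj (A $$ (i, j))"
    and cp: "char_poly A = (\<Prod>z\<leftarrow>zs. [:- z, 1:])" and len: "length zs = n"
    and "c \<ge> 0" and energy: "(\<Sum>z\<leftarrow>zs. cmod z) = real n * sqrt c"
    and tr: "mat_trace (A * A) = - of_real (real n * c)"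
    and ij: "i < n" "j < n"
  shows "(A * A) $$ (i, j) = (if i = j then - of_real c else 0)"
proof -
  define C where "C = A * A"
  have C: "C \<in> carrier_mat n n" using A by (simp add: C_def)
  have C2: "A ^\<^sub>m 2 = C"
    using A by (simp add: C_def numeral_2_eq_2)
  have C4: "A ^\<^sub>m 4 = C * C"
  proof -
    have "A ^\<^sub>m 4 = C * A * A"
      using A by (simp add: C_def numeral_eq_Suc)
    then show ?thesis using A by (simp add: C_def assoc_mult_mat[of _ n n _ n _ n])
  qed
  have hermitian: "C $$ (j, i) = cnj (C $$ (i, j))" if "i < n" "j < n" for i j
  proof -
    have "C $$ (j, i) = (\<Sum>k<n. A $$ (j, k) * A $$ (k, i))"
      unfolding C_def by (rule mult_mat_entry[OF A A that(2,1)])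
    also have "\<dots> = (\<Sum>k<n. cnj (A $$ (i, k) * A $$ (k, j)))"
    proof (rule sum.cong[OF refl])
      fix k assume "k \<in> {..<n}"
      then show "A $$ (j, k) * A $$ (k, i) = cnj (A $$ (i, k) * A $$ (k, j))"
        using skew[of k j] skew[of i k] that by simp
    qed
    also have "\<dots> = cnj (C $$ (i, j))"
      unfolding C_def mult_mat_entry[OF A A that] by simp
    finally show ?thesis .
  qed
  have square: "z\<^sup>2 = - of_real ((cmod z)\<^sup>2)" if z: "z \<in> set zs" for z
  proof -
    obtain v where "v \<in> carrier_vec n" "v \<noteq> 0\<^sub>v n" "A *\<^sub>v v = z \<cdot>\<^sub>v v"
      using eigenvector_of_root[OF A cp z] by blast
    then have "Re z = 0"
      using skew_hermitian_eigenvalue_imaginary[OF A skew] by blast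
    then show ?thesis
      by (simp add: complex_eq_iff cmod_eq_Im power2_eq_square)
  qed
  have "(\<Sum>z\<leftarrow>zs. z\<^sup>2) = - of_real (real n * c)"
    using mat_trace_pow_eq_sum_eigenvalues[OF A cp, of 2] tr by (simp add: C2 C_def)
  moreover have "(\<Sum>z\<leftarrow>zs. z\<^sup>2) = (\<Sum>z\<leftarrow>zs. - of_real ((cmod z)\<^sup>2))"
    using square by (intro arg_cong[of _ _ sum_list] map_cong refl)
  moreover have "(\<Sum>z\<leftarrow>as. - of_real ((cmod z)\<^sup>2)) = (- of_real (\<Sum>z\<leftarrow>as. (cmod z)\<^sup>2) :: complex)"
    for as by (induction as) simp_all
  ultimately have "(of_real (\<Sum>z\<leftarrow>zs. (cmod z)\<^sup>2) :: complex) = of_real (real n * c)"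
    by (metis neg_equal_iff_equal)
  then have "(\<Sum>z\<leftarrow>zs. (cmod z)\<^sup>2) = real n * c"
    by (simp only: of_real_eq_iff)
  then have modulus: "cmod z = sqrt c" if "z \<in> set zs" for z
    using all_eq_of_sum_and_sum_squares[of "map cmod zs" "sqrt c" "cmod z"] that energy len \<open>c \<ge> 0\<close>
    by (simp add: o_def)
  have fourth: "z ^ 4 = of_real (c\<^sup>2)" if "z \<in> set zs" for z
  proof -
    have "z ^ 4 = (z\<^sup>2)\<^sup>2" by (simp flip: power_mult)
    also have "z\<^sup>2 = - of_real c"
      using square[OF that] modulus[OF that] \<open>c \<ge> 0\<close> by simp
    finally show ?thesis by simp
  qed
  have trC: "(\<Sum>i<n. C $$ (i, i)) = - of_real (real n * c)"
    using tr A by (simp add: mat_trace_def C_def)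
  have trCC: "(\<Sum>i<n. \<Sum>j<n. C $$ (i, j) * C $$ (j, i)) = of_real (real n * c\<^sup>2)"
  proof -
    have "(\<Sum>i<n. \<Sum>j<n. C $$ (i, j) * C $$ (j, i)) = mat_trace (C * C)"
      using C mult_mat_entry[OF C C] by (simp add: mat_trace_def)
    also have "\<dots> = (\<Sum>z\<leftarrow>zs. z ^ 4)"
      using mat_trace_pow_eq_sum_eigenvalues[OF A cp, of 4] by (simp add: C4)
    also have "\<dots> = (\<Sum>z\<leftarrow>zs. of_real (c\<^sup>2))"
      using fourth by (intro arg_cong[of _ _ sum_list] map_cong refl)
    also have "\<dots> = of_real (real n * c\<^sup>2)"
      by (simp add: sum_list_triv len)
    finally show ?thesis .
  qed
  \<comment> \<open>The entries of \<open>A\<^sup>2 + c I\<close>; the goal is that they are all zero.\<close>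
  define N where "N i j = C $$ (i, j) + (if i = j then of_real c else 0)" for i j
  have norm_N: "of_real ((cmod (N i j))\<^sup>2) = C $$ (i, j) * C $$ (j, i)
      + (if i = j then 2 * of_real c * C $$ (i, i) + of_real (c\<^sup>2) else 0)"
    if "i < n" "j < n" for i j
  proof -
    have "of_real ((cmod (N i j))\<^sup>2) = N i j * cnj (N i j)"
      by (rule complex_norm_square)
    also have "cnj (N i j) = N j i"
      using hermitian[OF that] by (simp add: N_def)
    also have "N i j * N j i = C $$ (i, j) * C $$ (j, i)
        + (if i = j then 2 * of_real c * C $$ (i, i) + of_real (c\<^sup>2) else 0)"
      by (cases "i = j") (simp_all add: N_def power2_eq_square algebra_simps)
    finally show ?thesis .
  qed
  have "of_real (\<Sum>i<n. \<Sum>j<n. (cmod (N i j))\<^sup>2) = (\<Sum>i<n. \<Sum>j<n. C $$ (i, j) * C $$ (j, i)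
      + (if i = j then 2 * of_real c * C $$ (i, i) + of_real (c\<^sup>2) else 0))"
    unfolding of_real_sum by (intro sum.cong refl norm_N) auto
  also have "\<dots> = of_real (real n * c\<^sup>2) + 2 * of_real c * (\<Sum>i<n. C $$ (i, i))
      + of_real (real n * c\<^sup>2)"
    by (simp add: sum.distrib trCC sum_distrib_left)
  also have "\<dots> = 0"
    unfolding trC by (simp add: power2_eq_square)
  finally have "(\<Sum>i<n. \<Sum>j<n. (cmod (N i j))\<^sup>2) = 0"
    by (simp only: of_real_eq_0_iff)
  then have "\<forall>i\<in>{..<n}. (\<Sum>j<n. (cmod (N i j))\<^sup>2) = 0"
    by (subst (asm) sum_nonneg_eq_0_iff) (auto intro: sum_nonneg)
  then have "N i j = 0"
    using ij by (simp add: sum_nonneg_eq_0_iff)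
  then show ?thesis
    unfolding N_def C_def[symmetric] by (cases "i = j") (simp_all add: eq_neg_iff_add_eq_0)
qed

lemma cmod_eigenvalue_of_square_scalar:
  fixes A :: "complex mat"
  assumes A: "A \<in> carrier_mat n n" and "c \<ge> 0"
    and sq: "\<And>i j. i < n \<Longrightarrow> j < n \<Longrightarrow> (A * A) $$ (i, j) = (if i = j then - of_real c else 0)"
    and v: "v \<in> carrier_vec n" "v \<noteq> 0\<^sub>v n" "A *\<^sub>v v = z \<cdot>\<^sub>v v"
  shows "cmod z = sqrt c"
proof -
  obtain i where i: "i < n" "v $ i \<noteq> 0"
    using v(1,2) by (metis carrier_vecD index_zero_vec(1,2) eq_vecI)
  have "A *\<^sub>v (A *\<^sub>v v) = z \<cdot>\<^sub>v (z \<cdot>\<^sub>v v)"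
    using A v by (simp add: mult_mat_vec)
  moreover have "A *\<^sub>v (A *\<^sub>v v) = A * A *\<^sub>v v"
    using A v(1) by (simp add: assoc_mult_mat_vec[of A n n A n])
  ultimately have "(A * A *\<^sub>v v) $ i = z\<^sup>2 * v $ i"
    using i v(1) by (simp add: power2_eq_square)
  moreover have "(A * A *\<^sub>v v) $ i = (\<Sum>j<n. (A * A) $$ (i, j) * v $ j)"
    using i A v(1) by (intro mult_mat_vec_entry) auto
  moreover have "\<dots> = (\<Sum>j<n. if i = j then - of_real c * v $ j else 0)"
    by (intro sum.cong refl) (simp add: sq[OF i(1)] del: index_mult_mat(1))
  ultimately have "z\<^sup>2 * v $ i = - of_real c * v $ i"
    using i by (simp only: sum.delta') simp
  then have "z\<^sup>2 = - of_real c" using i(2) by (metis mult_right_cancel)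
  then have "(cmod z)\<^sup>2 = c"
    using \<open>c \<ge> 0\<close> by (simp flip: norm_power)
  then show ?thesis by (metis norm_ge_zero real_sqrt_unique)
qed

section \<open>Maximum skew energy as a matrix equation\<close>

definition skew_entry :: "'a pair_pre_digraph \<Rightarrow> 'a \<Rightarrow> 'a \<Rightarrow> complex" where
  "skew_entry D x y = (if (x, y) \<in> parcs D then 1 else if (y, x) \<in> parcs D then - 1 else 0)"

text \<open>
  This is \<open>S\<^sup>2 = - k I\<close>, phrased over the vertex set so that no numbering of the
  vertices enters the computation for products.
\<close>

definition skew_square_scalar :: "'a pair_pre_digraph \<Rightarrow> nat \<Rightarrow> bool" where
  "skew_square_scalar D k \<longleftrightarrow> (\<forall>x\<in>pverts D. \<forall>y\<in>pverts D.
     (\<Sum>z\<in>pverts D. skew_entry D x z * skew_entry D z y) = (if x = y then - of_nat k else 0))"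

lemma skew_adjacency_mat_carrier:
  "skew_adjacency_mat vs D \<in> carrier_mat (length vs) (length vs)"
  by (simp add: skew_adjacency_mat_def)

lemma skew_adjacency_mat_entry:
  "p < length vs \<Longrightarrow> q < length vs \<Longrightarrow> skew_adjacency_mat vs D $$ (p, q) = skew_entry D (vs ! p) (vs ! q)"
  by (simp add: skew_adjacency_mat_def skew_entry_def)

lemma sum_vertex_enumeration:
  assumes "vertex_enumeration D vs"
  shows "(\<Sum>p<length vs. f (vs ! p)) = (\<Sum>x\<in>pverts D. f x)"
  using assms sum.reindex_bij_betw[OF bij_betw_nth, of vs "{..<length vs}" "pverts D" f]
  by (auto simp: vertex_enumeration_def)

lemma skew_adjacency_mat_square_entry:
  assumes "vertex_enumeration D vs" and "p < length vs" and "q < length vs"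
  shows "(skew_adjacency_mat vs D * skew_adjacency_mat vs D) $$ (p, q)
    = (\<Sum>z\<in>pverts D. skew_entry D (vs ! p) z * skew_entry D z (vs ! q))"
  unfolding mult_mat_entry[OF skew_adjacency_mat_carrier skew_adjacency_mat_carrier assms(2,3)]
    sum_vertex_enumeration[OF assms(1), symmetric]
  using assms(2,3) by (intro sum.cong refl) (simp add: skew_adjacency_mat_entry)

lemma skew_energy_of_skew_square_scalar:
  assumes vs: "vertex_enumeration D vs" and sq: "skew_square_scalar D k"
  shows "skew_energy vs D = real (card (pverts D)) * sqrt (real k)"
proof -
  define S where "S = skew_adjacency_mat vs D"
  define n where "n = length vs"
  have S: "S \<in> carrier_mat n n"
    unfolding S_def n_def by (rule skew_adjacency_mat_carrier)
  have n: "card (pverts D) = n"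
    using vs distinct_card[of vs] by (simp add: vertex_enumeration_def n_def)
  obtain zs where cp: "char_poly S = (\<Prod>z\<leftarrow>zs. [:- z, 1:])" and len: "length zs = n"
    using char_poly_factorized[OF S] by blast
  have entry: "(S * S) $$ (p, q) = (if p = q then - of_real (real k) else 0)"
    if "p < n" "q < n" for p q
  proof -
    have "vs ! p \<in> pverts D" "vs ! q \<in> pverts D" "vs ! p = vs ! q \<longleftrightarrow> p = q"
      using vs that nth_mem[of p vs] nth_mem[of q vs]
      by (auto simp: vertex_enumeration_def n_def nth_eq_iff_index_eq)
    then show ?thesis
      using sq that skew_adjacency_mat_square_entry[OF vs, of p q]
      by (simp add: skew_square_scalar_def S_def n_def)
  qed
  have "cmod z = sqrt (real k)" if z: "z \<in> set zs" for z
    using eigenvector_of_root[OF S cp z] cmod_eigenvalue_of_square_scalar[OF S _ entry]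
    by (metis of_nat_0_le_iff)
  then have "(\<Sum>z\<leftarrow>zs. cmod z) = (\<Sum>z\<leftarrow>zs. sqrt (real k))"
    by (intro arg_cong[of _ _ sum_list] map_cong refl)
  then show ?thesis
    unfolding skew_energy_def Let_def S_def[symmetric] sum_spectrum_order_eq_sum_list[OF S cp]
    by (simp add: sum_list_triv len n)
qed

lemma skew_entry_swap:
  assumes "is_orientation G D"
  shows "skew_entry D y x = - cnj (skew_entry D x y)"
  using assms by (auto simp: skew_entry_def is_orientation_def)

text \<open>
  Each neighbour of \<open>x\<close> contributes \<open>1 \<cdot> (- 1)\<close> to the diagonal entry of \<open>S\<^sup>2\<close>.
\<close>

lemma skew_square_diagonal:
  assumes "pair_graph G" and or: "is_orientation G D"
  shows "(\<Sum>z\<in>pverts D. skew_entry D x z * skew_entry D z x) = - of_nat (out_degree (with_proj G) x)"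
proof -
  interpret pair_graph G by fact
  have V: "pverts D = pverts G" using or by (simp add: is_orientation_def)
  have arcs: "(x, z) \<in> parcs G \<longleftrightarrow> (x, z) \<in> parcs D \<or> (z, x) \<in> parcs D"
    "\<not> ((x, z) \<in> parcs D \<and> (z, x) \<in> parcs D)" for z
    using or by (auto simp: is_orientation_def)
  have "out_arcs (with_proj G) x = Pair x ` {z \<in> pverts G. (x, z) \<in> parcs G}"
    using wellformed' by (auto simp: out_arcs_def)
  then have deg: "out_degree (with_proj G) x = card {z \<in> pverts G. (x, z) \<in> parcs G}"
    by (simp add: out_degree_def card_image inj_on_def)
  have "(\<Sum>z\<in>pverts D. skew_entry D x z * skew_entry D z x)
    = (\<Sum>z\<in>pverts G. if (x, z) \<in> parcs G then - 1 else 0)"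
    unfolding V by (intro sum.cong refl) (use arcs in \<open>auto simp: skew_entry_def\<close>)
  also have "\<dots> = - of_nat (card {z \<in> pverts G. (x, z) \<in> parcs G})"
    using pair_finite_verts by (simp add: sum.If_cases Int_def)
  finally show ?thesis unfolding deg .
qed

lemma skew_square_scalar_of_skew_energy:
  assumes G: "pair_graph G" and or: "is_orientation G D" and reg: "regular_graph k G"
    and vs: "vertex_enumeration G vs"
    and energy: "skew_energy vs D = real (card (pverts G)) * sqrt (real k)"
  shows "skew_square_scalar D k"
proof -
  define S where "S = skew_adjacency_mat vs D"
  define n where "n = length vs"
  have V: "pverts D = pverts G" using or by (simp add: is_orientation_def)
  have vsD: "vertex_enumeration D vs" using vs by (simp add: vertex_enumeration_def V)
  have S: "S \<in> carrier_mat n n"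
    unfolding S_def n_def by (rule skew_adjacency_mat_carrier)
  have n: "card (pverts G) = n"
    using vs distinct_card[of vs] by (simp add: vertex_enumeration_def n_def)
  obtain zs where cp: "char_poly S = (\<Prod>z\<leftarrow>zs. [:- z, 1:])" and len: "length zs = n"
    using char_poly_factorized[OF S] by blast
  have skew: "S $$ (q, p) = - cnj (S $$ (p, q))" if "p < n" "q < n" for p q
    using that skew_entry_swap[OF or, of "vs ! q" "vs ! p"]
    by (simp add: S_def n_def skew_adjacency_mat_entry)
  have "(\<Sum>z\<leftarrow>zs. cmod z) = real n * sqrt (real k)"
    using energy unfolding skew_energy_def Let_def S_def[symmetric]
      sum_spectrum_order_eq_sum_list[OF S cp] n .
  moreover have "mat_trace (S * S) = - of_real (real n * real k)"
  proof -
    have "mat_trace (S * S) = (\<Sum>p<n. - of_nat k)"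
    proof -
      have "(S * S) $$ (p, p) = - of_nat k" if "p < n" for p
      proof -
        have "vs ! p \<in> pverts G"
          using vs that nth_mem[of p vs] by (simp add: vertex_enumeration_def n_def)
        then show ?thesis
          using that skew_adjacency_mat_square_entry[OF vsD, of p p] reg
          by (simp add: S_def n_def skew_square_diagonal[OF G or] regular_graph_def)
      qed
      then show ?thesis using S by (simp add: mat_trace_def)
    qed
    then show ?thesis by simp
  qed
  ultimately have entry: "(S * S) $$ (p, q) = (if p = q then - of_real (real k) else 0)"
    if "p < n" "q < n" for p q
    using that by (intro skew_hermitian_square_eq_scalar[OF S skew cp len]) auto
  show ?thesis
    unfolding skew_square_scalar_def
  proof (intro ballI)
    fix x y assume "x \<in> pverts D" "y \<in> pverts D"
    then obtain p q where pq: "p < n" "q < n" "x = vs ! p" "y = vs ! q"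
      using vsD unfolding vertex_enumeration_def n_def by (metis in_set_conv_nth)
    moreover have "x = y \<longleftrightarrow> p = q"
      using pq vs by (simp add: vertex_enumeration_def n_def nth_eq_iff_index_eq)
    ultimately show "(\<Sum>z\<in>pverts D. skew_entry D x z * skew_entry D z y)
      = (if x = y then - of_nat k else 0)"
      using entry[OF pq(1,2)] skew_adjacency_mat_square_entry[OF vsD, of p q]
      by (simp add: S_def n_def)
  qed
qed

section \<open>The product orientation\<close>

lemma skew_entry_product:
  assumes H: "is_orientation H H\<tau>" and G: "is_orientation G G\<sigma>"
    and V: "u1 \<in> pverts H" "u2 \<in> pverts H" "v1 \<in> pverts G" "v2 \<in> pverts G"
  shows "skew_entry (reverse_fibre_arcs Y (H\<tau> \<box> G\<sigma>)) (u1, v1) (u2, v2)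
    = (if u1 = u2 then (if u1 \<in> Y then - 1 else 1) * skew_entry G\<sigma> v1 v2 else 0)
      + (if v1 = v2 then skew_entry H\<tau> u1 u2 else 0)"
proof -
  let ?D = "reverse_fibre_arcs Y (H\<tau> \<box> G\<sigma>)"
  have verts: "pverts H\<tau> = pverts H" "pverts G\<sigma> = pverts G"
    using H G by (auto simp: is_orientation_def)
  have H_loop: "(a, a) \<notin> parcs H\<tau>" for a
    using H by (auto simp: is_orientation_def)
  have G_arc: "(b, a) \<notin> parcs G\<sigma>" if "(a, b) \<in> parcs G\<sigma>" for a b
    using G that by (auto simp: is_orientation_def)
  have G_loop: "(b, b) \<notin> parcs G\<sigma>" for b
    using G_arc by blast
  have arc: "((a1, b1), (a2, b2)) \<in> parcs ?D \<longleftrightarrow>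
      a1 = a2 \<and> (if a1 \<in> Y then (b2, b1) else (b1, b2)) \<in> parcs G\<sigma> \<or> b1 = b2 \<and> (a1, a2) \<in> parcs H\<tau>"
    if "a1 \<in> pverts H" "a2 \<in> pverts H" "b1 \<in> pverts G" "b2 \<in> pverts G" for a1 a2 b1 b2
    using that H_loop by (cases "a1 = a2") (simp_all add: reverse_fibre_arcs_def cartesian_product_def verts)
  show ?thesis
    unfolding skew_entry_def arc[OF V] arc[OF V(2,1) V(4,3)]
    using G_arc[of v1 v2] by (cases "u1 = u2"; cases "v1 = v2") (simp_all add: H_loop G_loop)
qed

text \<open>
  In the expansion of \<open>W\<^sup>2\<close> the inner sum over the product collapses along each Kronecker delta.
  The two mixed terms are \<open>(\<epsilon> u1 + \<epsilon> u2) s\<^sub>H(u1, u2) s\<^sub>G(v1, v2)\<close>, where one of the two factors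
  \<open>\<epsilon> u1 + \<epsilon> u2\<close> and \<open>s\<^sub>H(u1, u2)\<close> is zero because \<open>H\<close> is bipartite.
\<close>

lemma skew_square_product:
  assumes H: "pair_graph H" "is_orientation H H\<tau>" and G: "pair_graph G" "is_orientation G G\<sigma>"
    and bip: "bipartition H X Y"
    and sqH: "skew_square_scalar H\<tau> l" and sqG: "skew_square_scalar G\<sigma> k"
  shows "skew_square_scalar (reverse_fibre_arcs Y (H\<tau> \<box> G\<sigma>)) (l + k)"
proof -
  define W where "W = skew_entry (reverse_fibre_arcs Y (H\<tau> \<box> G\<sigma>))"
  define \<epsilon> :: "'a \<Rightarrow> complex" where "\<epsilon> u = (if u \<in> Y then - 1 else 1)" for u
  let ?s = "skew_entry H\<tau>" and ?t = "skew_entry G\<sigma>"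
  have V: "pverts H\<tau> = pverts H" "pverts G\<sigma> = pverts G"
    using H(2) G(2) by (auto simp: is_orientation_def)
  have fin: "finite (pverts H)" "finite (pverts G)"
    using H(1) G(1) by (auto intro: pair_fin_digraph.pair_finite_verts
        simp: pair_graph_def pair_digraph_def)
  have W: "W (u1, v1) (u2, v2)
      = (if u1 = u2 then \<epsilon> u1 * ?t v1 v2 else 0) + (if v1 = v2 then ?s u1 u2 else 0)"
    if "u1 \<in> pverts H" "u2 \<in> pverts H" "v1 \<in> pverts G" "v2 \<in> pverts G" for u1 u2 v1 v2
    unfolding W_def \<epsilon>_def by (rule skew_entry_product[OF H(2) G(2) that])
  have anti: "(\<epsilon> u1 + \<epsilon> u2) * ?s u1 u2 = 0" for u1 u2
  proof (cases "(u1, u2) \<in> parcs H")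
    case True
    then have "\<epsilon> u1 + \<epsilon> u2 = 0" using bip by (auto simp: bipartition_def \<epsilon>_def)
    then show ?thesis by simp
  next
    case False
    then have "?s u1 u2 = 0" using H(2) by (auto simp: is_orientation_def skew_entry_def)
    then show ?thesis by simp
  qed
  have sum_square: "(\<Sum>z\<in>pverts H \<times> pverts G. W (u1, v1) z * W z (u2, v2))
      = (if (u1, v1) = (u2, v2) then - of_nat (l + k) else 0)"
    if u: "u1 \<in> pverts H" "u2 \<in> pverts H" and v: "v1 \<in> pverts G" "v2 \<in> pverts G"
    for u1 u2 v1 v2
  proof -
    have "(\<Sum>z\<in>pverts H \<times> pverts G. W (u1, v1) z * W z (u2, v2))
      = (\<Sum>u\<in>pverts H. \<Sum>v\<in>pverts G. W (u1, v1) (u, v) * W (u, v) (u2, v2))"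
      by (simp add: sum.cartesian_product)
    also have "\<dots> = (\<Sum>u\<in>pverts H. \<Sum>v\<in>pverts G.
        (if u = u1 then if u1 = u2 then ?t v1 v * ?t v v2 else 0 else 0)
        + (if u = u1 then if v = v2 then \<epsilon> u1 * ?t v1 v2 * ?s u1 u2 else 0 else 0)
        + (if u = u2 then if v = v1 then ?s u1 u2 * (\<epsilon> u2 * ?t v1 v2) else 0 else 0)
        + (if v = v1 then if v1 = v2 then ?s u1 u * ?s u u2 else 0 else 0))"
      by (intro sum.cong refl) (auto simp: W u v \<epsilon>_def algebra_simps)
    also have "\<dots> = (if u1 = u2 then \<Sum>v\<in>pverts G. ?t v1 v * ?t v v2 else 0)
        + \<epsilon> u1 * ?t v1 v2 * ?s u1 u2 + ?s u1 u2 * (\<epsilon> u2 * ?t v1 v2)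
        + (if v1 = v2 then \<Sum>u\<in>pverts H. ?s u1 u * ?s u u2 else 0)"
    proof -
      have swap: "(\<Sum>v\<in>pverts G. if u = w then f v else 0) = (if u = w then sum f (pverts G) else 0)"
        for u w :: 'a and f :: "'b \<Rightarrow> complex" by simp
      show ?thesis
        using u v fin by (simp add: sum.distrib swap)
    qed
    also have "\<dots> = (if u1 = u2 then \<Sum>v\<in>pverts G. ?t v1 v * ?t v v2 else 0)
        + (\<epsilon> u1 + \<epsilon> u2) * ?s u1 u2 * ?t v1 v2
        + (if v1 = v2 then \<Sum>u\<in>pverts H. ?s u1 u * ?s u u2 else 0)"
      by (simp add: algebra_simps)
    also have "\<dots> = (if (u1, v1) = (u2, v2) then - of_nat (l + k) else 0)"
      using sqH sqG u v by (simp add: anti skew_square_scalar_def V)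
    finally show ?thesis .
  qed
  have "pverts (reverse_fibre_arcs Y (H\<tau> \<box> G\<sigma>)) = pverts H \<times> pverts G"
    by (simp add: reverse_fibre_arcs_def cartesian_product_def V)
  then show ?thesis
    using sum_square by (auto simp: skew_square_scalar_def simp flip: W_def)
qed

text \<open>
  Minus the vertex degrees stand on the diagonal of \<open>S\<^sup>2\<close>, so the matrix equation determines them.
\<close>

lemma max_degree_of_skew_square_scalar:
  assumes G: "pair_graph G" and or: "is_orientation G D" and sq: "skew_square_scalar D k"
    and ne: "pverts G \<noteq> {}"
  shows "max_degree G = k"
proof -
  have V: "pverts D = pverts G" using or by (simp add: is_orientation_def)
  have "out_degree (with_proj G) x = k" if "x \<in> pverts G" for x
  proof -
    have "- (of_nat (out_degree (with_proj G) x) :: complex) = - of_nat k"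
      using sq that unfolding skew_square_diagonal[OF G or, symmetric]
      by (simp add: skew_square_scalar_def V)
    then show ?thesis by simp
  qed
  then have "out_degree (with_proj G) ` pverts G = {k}" using ne by auto
  then show ?thesis by (simp add: max_degree_def)
qed

theorem theorem3p2:
  fixes H H\<tau> :: "'a pair_pre_digraph" and G G\<sigma> :: "'b pair_pre_digraph"
    and X Y :: "'a set" and l k m n :: nat
    and us :: "'a list" and vs :: "'b list" and ws :: "('a \<times> 'b) list"
  assumes "pair_graph H" and "is_orientation H H\<tau>"
    and "regular_graph l H" and "bipartition H X Y" and "card (pverts H) = m"
    and "vertex_enumeration H us"
    and "has_max_skew_energy us H H\<tau>" and "skew_energy us H\<tau> = real m * sqrt (real l)"
    and "pair_graph G" and "is_orientation G G\<sigma>"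
    and "regular_graph k G" and "card (pverts G) = n"
    and "vertex_enumeration G vs"
    and "has_max_skew_energy vs G G\<sigma>" and "skew_energy vs G\<sigma> = real n * sqrt (real k)"
    and "vertex_enumeration (H \<box> G) ws"
  shows "has_max_skew_energy ws (H \<box> G) (reverse_fibre_arcs Y (H\<tau> \<box> G\<sigma>)) \<and>
         skew_energy ws (reverse_fibre_arcs Y (H\<tau> \<box> G\<sigma>)) = real (m * n) * sqrt (real (l + k))"
proof -
  let ?P = "H \<box> G" and ?D = "reverse_fibre_arcs Y (H\<tau> \<box> G\<sigma>)"
  have P: "pair_graph ?P"
    by (rule pair_graph_cartesian_product[OF assms(1,9)])
  have or: "is_orientation ?P ?D"
    by (rule is_orientation_product(2)[OF assms(1,2,9,10)])
  have V: "pverts ?D = pverts ?P" using or by (simp add: is_orientation_def)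
  have card: "card (pverts ?P) = m * n"
    using assms(5,12) by (simp add: cartesian_product_def card_cartesian_product)
  have "skew_square_scalar H\<tau> l"
    using assms(5,8) by (intro skew_square_scalar_of_skew_energy[OF assms(1,2,3,6)]) simp
  moreover have "skew_square_scalar G\<sigma> k"
    using assms(12,15) by (intro skew_square_scalar_of_skew_energy[OF assms(9,10,11,13)]) simp
  ultimately have sq: "skew_square_scalar ?D (l + k)"
    by (rule skew_square_product[OF assms(1,2,9,10,4)])
  have "vertex_enumeration ?D ws"
    using assms(16) by (simp add: vertex_enumeration_def V)
  then have energy: "skew_energy ws ?D = real (m * n) * sqrt (real (l + k))"
    using skew_energy_of_skew_square_scalar[OF _ sq] by (simp add: V card)
  moreover have "has_max_skew_energy ws ?P ?D"
  proof (cases "pverts ?P = {}")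
    \<comment> \<open>The maximum degree of an empty graph is unspecified, but then both sides carry a factor \<open>0\<close>.\<close>
    case True
    then have "m * n = 0" using card by simp
    then show ?thesis by (simp add: has_max_skew_energy_def energy card)
  next
    case False
    then show ?thesis
      by (simp add: has_max_skew_energy_def energy card max_degree_of_skew_square_scalar[OF P or sq])
  qed
  ultimately show ?thesis by blast
qed

end
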